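(* Let $S$ be a numerical semigroup of depth $q\ge 4$, and let $h=\lceil q/2\rceil$. Assume that $\alpha_i=0$ for all $1\le i\le h-1$. Then $W_0(S)\ge 0$.
   Context: A numerical semigroup is a submonoid $S$ of $(\mathbb N,+)$ with $\mathbb N\setminus S$ finite. Let $S^*=S\setminus\{0\}$, $m=\min S^*$ (multiplicity), $c$ the least $c\in\mathbb N$ with $[c,\infty[\subseteq S$ (conductor), $L=S\cap[0,c-1]$ (left part), $P$ the set of primitive elements of $S$ (elements of $S^*$ not expressible as a sum of two elements of $S^*$; it is the minimal generating set), and $D=S^*\setminus P=S^*+S^*$. The depth is $q=\lceil c/m\rceil$ and the offset is $\rho=qm-c\in[0,m-1]$. For $j\in\mathbb Z$ let $I_j=[jm-\rho,(j+1)m-\rho-1]$ and $D_j=D\cap I_j$. Let $A=\{x\in S: x-m\notin S\}$ be the Apéry set of $S$ with respect to $m$, $A_i=A\cap I_i$ and $\alpha_i=|A_i|$. Define $W_0(S)=|P\cap L|\,|L|-q|D_q|+\rho$. *)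

theory Defs
  imports Complex_Main
begin

definition numerical_semigroup :: "nat set \<Rightarrow> bool" where
  "numerical_semigroup S \<longleftrightarrow>
     0 \<in> S \<and> (\<forall>x\<in>S. \<forall>y\<in>S. x + y \<in> S) \<and> finite (UNIV - S)"

definition ns_star :: "nat set \<Rightarrow> nat set" where
  "ns_star S = S - {0}"

definition ns_multiplicity :: "nat set \<Rightarrow> nat" where
  "ns_multiplicity S = (LEAST m. m \<in> ns_star S)"

definition ns_conductor :: "nat set \<Rightarrow> nat" where
  "ns_conductor S = (LEAST c. {c..} \<subseteq> S)"

definition ns_left :: "nat set \<Rightarrow> nat set" where
  "ns_left S = S \<inter> {..<ns_conductor S}"

definition ns_primitive :: "nat set \<Rightarrow> nat set" where
  "ns_primitive S = {x \<in> ns_star S. \<not> (\<exists>a\<in>ns_star S. \<exists>b\<in>ns_star S. x = a + b)}"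

definition ns_decomposable :: "nat set \<Rightarrow> nat set" where
  "ns_decomposable S = ns_star S - ns_primitive S"

text \<open>Depth, offset and the interval bounds are integers, so that no subtraction is truncated.\<close>

definition ns_depth :: "nat set \<Rightarrow> int" where
  "ns_depth S = \<lceil>real (ns_conductor S) / real (ns_multiplicity S)\<rceil>"

definition ns_offset :: "nat set \<Rightarrow> int" where
  "ns_offset S = ns_depth S * int (ns_multiplicity S) - int (ns_conductor S)"

definition ns_interval :: "nat set \<Rightarrow> int \<Rightarrow> int set" where
  "ns_interval S j =
     {j * int (ns_multiplicity S) - ns_offset S ..
      (j + 1) * int (ns_multiplicity S) - ns_offset S - 1}"

definition ns_decomposable_in :: "nat set \<Rightarrow> int \<Rightarrow> nat set" where
  "ns_decomposable_in S j = {x \<in> ns_decomposable S. int x \<in> ns_interval S j}"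

text \<open>The condition \<open>x - m \<notin> S\<close> refers to integer subtraction, hence the image
  of \<open>S\<close> in the integers: every element of \<open>S\<close> below \<open>m\<close> satisfies it.\<close>

definition ns_apery :: "nat set \<Rightarrow> nat set" where
  "ns_apery S = {x \<in> S. int x - int (ns_multiplicity S) \<notin> int ` S}"

definition ns_apery_in :: "nat set \<Rightarrow> int \<Rightarrow> nat set" where
  "ns_apery_in S i = {x \<in> ns_apery S. int x \<in> ns_interval S i}"

definition ns_alpha :: "nat set \<Rightarrow> int \<Rightarrow> nat" where
  "ns_alpha S i = card (ns_apery_in S i)"

definition ns_W0 :: "nat set \<Rightarrow> int" where
  "ns_W0 S = int (card (ns_primitive S \<inter> ns_left S)) * int (card (ns_left S))
     - ns_depth S * int (card (ns_decomposable_in S (ns_depth S))) + ns_offset S"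

end

theory Submission
  imports Defs
begin

text \<open>Let \<open>lev x = (x + \<rho>) div m\<close> be the index of the interval \<open>I\<^sub>j\<close> containing \<open>x\<close>, and let
  \<open>B\<close> be the set of Apery elements of level in \<open>[h, q[\<close>. Every element of \<open>S\<close> is an Apery
  element plus a multiple of \<open>m\<close>; counting over \<open>insert 0 B\<close> gives
  \<open>|L| \<ge> q + weight\<close>, \<open>|P \<inter> L| \<ge> 1 + |B - D|\<close> and \<open>|D\<^sub>q| \<le> 1 + |B| + |A\<^sub>q \<inter> D|\<close>, where \<open>weight\<close>
  is the sum of \<open>q - lev x\<close> over \<open>B\<close>. It remains to show
  \<open>q (|B \<inter> D| + |A\<^sub>q \<inter> D|) \<le> (1 + |B - D|) weight + \<rho>\<close>. A decomposable Apery element of level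
  at most \<open>q\<close> has both summands in \<open>A\<^sub>h\<close>, or one in \<open>A\<^sub>h\<close> and the other in \<open>A\<^bsub>h+1\<^esub>\<close>, which bounds
  the number of these elements quadratically; at most \<open>\<rho>\<close> of them have a level smaller than
  the sum of the levels of their summands. The delicate case is \<open>q = 4\<close>, where \<open>A\<^sub>3\<close> may
  itself contain decomposable elements; there triple sums from \<open>A\<^sub>2\<close> are counted three times.\<close>

section \<open>Cardinalities of sumsets of finite sets\<close>

lemma card_pair_sums:
  fixes H :: "nat set"
  assumes "finite H"
  shows "finite {a + b | a b. a \<in> H \<and> b \<in> H} \<and>
    2 * card {a + b | a b. a \<in> H \<and> b \<in> H} \<le> card H * (card H + 1)"
  using assms
proof (induction H rule: finite_induct)
  case empty
  then show ?case by simp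
next
  case (insert x H)
  let ?T = "{a + b | a b. a \<in> H \<and> b \<in> H}"
  let ?N = "(\<lambda>b. x + b) ` insert x H"
  \<comment> \<open>By commutativity every new sum has the form \<open>x + b\<close>; hence a
    triangular number instead of a square.\<close>
  have eq: "{a + b | a b. a \<in> insert x H \<and> b \<in> insert x H} = ?T \<union> ?N"
    by (auto simp: add.commute)
  have "card (?T \<union> ?N) \<le> card ?T + card ?N" by (rule card_Un_le)
  moreover have "card ?N \<le> card (insert x H)" by (rule card_image_le) (use insert in simp)
  ultimately show ?case
    unfolding eq using insert by (simp add: algebra_simps)
qed

lemma card_sums_le:
  fixes H K :: "nat set"
  assumes "finite H" "finite K"
  shows "finite {a + b | a b. a \<in> H \<and> b \<in> K} \<and>
    card {a + b | a b. a \<in> H \<and> b \<in> K} \<le> card H * card K"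
proof -
  have eq: "{a + b | a b. a \<in> H \<and> b \<in> K} = (\<lambda>(a, b). a + b) ` (H \<times> K)" by auto
  show ?thesis
    unfolding eq using assms card_image_le[of "H \<times> K" "\<lambda>(a, b). a + b"]
    by (auto simp: card_cartesian_product)
qed

lemma sum_card_fibres_le:
  assumes "finite X" "finite P"
  shows "(\<Sum>x\<in>X. card {p \<in> P. \<phi> p = x}) \<le> card P"
proof -
  have "(\<Sum>x\<in>X. card {p \<in> P. \<phi> p = x}) = card (\<Union>x\<in>X. {p \<in> P. \<phi> p = x})"
    by (rule card_UN_disjoint[symmetric]) (use assms in auto)
  also have "\<dots> \<le> card P" by (rule card_mono) (use assms in auto)
  finally show ?thesis .
qed

lemma two_le_card:
  assumes "finite C" "x \<in> C" "y \<in> C" "x \<noteq> y"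
  shows "2 \<le> card C"
  using card_mono[of C "{x, y}"] assms by simp

lemma three_le_card:
  assumes "finite C" "x \<in> C" "y \<in> C" "z \<in> C" "x \<noteq> y" "x \<noteq> z" "y \<noteq> z"
  shows "3 \<le> card C"
  using card_mono[of C "{x, y, z}"] assms by simp

text \<open>Every \<open>s \<in> E\<close> occurs in \<open>card H\<close> pairs \<open>(s, c)\<close>, and in two more through a chosen
  decomposition \<open>s = f s + g s\<close>. These two make up for the triples \<open>a + b + c\<close> with
  repeated entries, so that every \<open>x \<in> X\<close> is hit at least three times.\<close>

lemma card_triple_sums:
  fixes H E X :: "nat set"
  assumes fin: "finite H" "finite E"
    and E: "\<And>s. s \<in> E \<Longrightarrow> \<exists>a\<in>H. \<exists>b\<in>H. s = a + b"
    and X: "\<And>x. x \<in> X \<Longrightarrow> \<exists>s\<in>E. \<exists>c\<in>H. x = s + c"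
    and closed: "\<And>a b c. a \<in> H \<Longrightarrow> b \<in> H \<Longrightarrow> c \<in> H \<Longrightarrow> a + b + c \<in> X \<Longrightarrow> a + b \<in> E"
  shows "3 * card X \<le> (card H + 2) * card E"
proof -
  have "X \<subseteq> {s + c | s c. s \<in> E \<and> c \<in> H}" using X by blast
  then have finX: "finite X"
    using card_sums_le[OF fin(2,1)] finite_subset by blast
  obtain f g where fg: "\<And>s. s \<in> E \<Longrightarrow> f s \<in> H \<and> g s \<in> H \<and> s = f s + g s"
    using E by metis
  \<comment> \<open>\<open>C x\<close> holds the representations \<open>x = s + c\<close>;
    \<open>F x\<close> and \<open>G x\<close> count \<open>s\<close> once more when \<open>c\<close>
    can be its chosen summand \<open>f s\<close> or \<open>g s\<close>. Over all \<open>x\<close>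
    these total at most \<open>card (E \<times> H) + 2 * card E\<close>.\<close>
  define C where "C x = {p \<in> E \<times> H. fst p + snd p = x}" for x
  define F where "F x = {s \<in> E. s + f s = x}" for x
  define G where "G x = {s \<in> E. s + g s = x}" for x
  have finC: "finite (C x)" for x using fin by (simp add: C_def)
  have finF: "finite (F x)" for x using fin by (simp add: F_def)
  have finG: "finite (G x)" for x using fin by (simp add: G_def)
  have three: "3 \<le> card (C x) + card (F x) + card (G x)" if xX: "x \<in> X" for x
  proof -
    have mem: "(a + b, c) \<in> C x" if "a \<in> H" "b \<in> H" "c \<in> H" "a + b + c = x" for a b c
      using closed[of a b c] that \<open>x \<in> X\<close> by (simp add: C_def)
    obtain s a where s: "s \<in> E" "a \<in> H" "x = s + a" using X[OF xX] by blast
    define u v where "u = f s" and "v = g s"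
    have uv: "u \<in> H" "v \<in> H" "s = u + v" using fg[OF s(1)] by (auto simp: u_def v_def)
    have Ca: "(u + v, a) \<in> C x" and Cu: "(v + a, u) \<in> C x" and Cv: "(u + a, v) \<in> C x"
      by (rule mem; use uv s in simp)+
    have Fs: "1 \<le> card (F x)" if "a = u"
      using card_mono[OF finF, of "{s}" x] that s by (simp add: F_def u_def)
    have Gs: "1 \<le> card (G x)" if "a = v"
      using card_mono[OF finG, of "{s}" x] that s by (simp add: G_def v_def)
    \<comment> \<open>The cases are the coincidences among the entries of
      \<open>x = u + v + a\<close>. Distinct entries give three pairs in \<open>C x\<close>; pairs
      lost by a coincidence have to be replaced.\<close>
    consider "a \<noteq> u" "a \<noteq> v" "u \<noteq> v" | "u = v" "a \<noteq> u" | "a = u" "u \<noteq> v"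
      | "a = v" "u \<noteq> v" | "a = u" "u = v" by blast
    then show ?thesis
    proof cases
      case 1
      have "3 \<le> card (C x)" by (rule three_le_card[OF finC Ca Cu Cv]) (use 1 in auto)
      then show ?thesis by simp
    next
      case 2
      have two: "2 \<le> card (C x)" by (rule two_le_card[OF finC Ca Cu]) (use 2 in auto)
      \<comment> \<open>Here \<open>x = t + u\<close>. If the chosen decomposition of
        \<open>t\<close> uses \<open>u\<close>, then \<open>t\<close> lies in \<open>F x\<close> or
        \<open>G x\<close>; otherwise it is not \<open>u + a\<close>, and regrouping
        \<open>u + g t + f t\<close> gives a third pair.\<close>
      define t where "t = u + a"
      have t: "t \<in> E" using closed[of u a v] uv s \<open>x \<in> X\<close> by (simp add: t_def ac_simps)
      have ft: "f t \<in> H" "g t \<in> H" "t = f t + g t" using fg[OF t] by auto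
      consider "f t = u" | "g t = u" | "f t \<noteq> u" "g t \<noteq> u" by blast
      then show ?thesis
      proof cases
        case a: 1
        have "{t} \<subseteq> F x" using t a 2 uv s by (auto simp: F_def t_def)
        then have "1 \<le> card (F x)" using card_mono[OF finF, of "{t}" x] by simp
        then show ?thesis using two by simp
      next
        case a: 2
        have "{t} \<subseteq> G x" using t a 2 uv s by (auto simp: G_def t_def)
        then have "1 \<le> card (G x)" using card_mono[OF finG, of "{t}" x] by simp
        then show ?thesis using two by simp
      next
        case a: 3
        have Ct: "(u + g t, f t) \<in> C x"
          by (rule mem) (use ft uv s 2 in \<open>auto simp: t_def\<close>)
        have "f t \<noteq> a" using a ft(3) by (auto simp: t_def)
        then have "3 \<le> card (C x)"
          by (intro three_le_card[OF finC Ca Cu Ct]) (use a 2 in auto)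
        then show ?thesis by simp
      qed
    next
      case 3
      have "2 \<le> card (C x)" by (rule two_le_card[OF finC Ca Cv]) (use 3 in auto)
      then show ?thesis using Fs 3 by simp
    next
      case 4
      have "2 \<le> card (C x)" by (rule two_le_card[OF finC Ca Cu]) (use 4 in auto)
      then show ?thesis using Gs 4 by simp
    next
      case 5
      have "1 \<le> card (C x)" using card_mono[OF finC, of "{(u + v, a)}" x] Ca by simp
      then show ?thesis using Fs Gs 5 by simp
    qed
  qed
  have "3 * card X = (\<Sum>x\<in>X. 3)" by simp
  also have "\<dots> \<le> (\<Sum>x\<in>X. card (C x) + card (F x) + card (G x))"
    by (rule sum_mono) (rule three)
  also have "\<dots> = (\<Sum>x\<in>X. card (C x)) + (\<Sum>x\<in>X. card (F x)) + (\<Sum>x\<in>X. card (G x))"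
    by (simp add: sum.distrib)
  also have "\<dots> \<le> card (E \<times> H) + card E + card E"
    unfolding C_def F_def G_def
    by (intro add_mono sum_card_fibres_le finX fin finite_cartesian_product)
  also have "\<dots> = (card H + 2) * card E" by (simp add: card_cartesian_product algebra_simps)
  finally show ?thesis .
qed

section \<open>Levels and the Apery set\<close>

locale semigroup_levels =
  fixes S :: "nat set" and m c q \<rho> :: nat
  assumes zero_in: "0 \<in> S"
    and add_in: "x \<in> S \<Longrightarrow> y \<in> S \<Longrightarrow> x + y \<in> S"
    and m_in: "m \<in> S"
    and m_le: "x \<in> S \<Longrightarrow> x \<noteq> 0 \<Longrightarrow> m \<le> x"
    and c_eq: "c + \<rho> = q * m"
    and \<rho>_less: "\<rho> < m"
    and q_ge: "2 \<le> q"
begin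

definition lev :: "nat \<Rightarrow> nat" where "lev x = (x + \<rho>) div m"

definition Ap :: "nat set" where "Ap = {x \<in> S. \<forall>y\<in>S. x \<noteq> y + m}"

definition Apl :: "nat \<Rightarrow> nat set" where "Apl i = {x \<in> Ap. lev x = i}"

definition Dec :: "nat set" where "Dec = {x. \<exists>a\<in>S - {0}. \<exists>b\<in>S - {0}. x = a + b}"

lemma m_pos: "0 < m" using \<rho>_less by simp

lemma lev_eq_iff: "lev x = i \<longleftrightarrow> i * m \<le> x + \<rho> \<and> x + \<rho> < (i + 1) * m"
proof -
  have "lev x = i \<longleftrightarrow> i \<le> lev x \<and> lev x < i + 1" by auto
  then show ?thesis
    unfolding lev_def using m_pos by (simp only: less_eq_div_iff_mult_less_eq div_less_iff_less_mult)
qed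

lemma lev_bounds: "lev x * m \<le> x + \<rho>" "x + \<rho> < (lev x + 1) * m"
  using lev_eq_iff[of x "lev x"] by auto

lemma lev_add_mult [simp]: "lev (x + j * m) = lev x + j"
proof -
  have "(x + j * m + \<rho>) div m = (x + \<rho> + j * m) div m" by (simp only: ac_simps)
  then show ?thesis using m_pos by (simp add: lev_def)
qed

text \<open>Since \<open>c + \<rho> = q * m\<close>, the interval of level \<open>q\<close> starts
  exactly at \<open>c\<close>.\<close>

lemma lev_less_iff: "lev x < q \<longleftrightarrow> x < c"
  unfolding lev_def using m_pos c_eq by (simp add: div_less_iff_less_mult) (metis add_less_cancel_right)

lemma lev_0 [simp]: "lev 0 = 0"
  by (simp add: lev_def \<rho>_less)

text \<open>Two summands bring in the offset twice, their sum only once; the excess \<rho> is below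
  \<open>m\<close> and so costs at most one level.\<close>

lemma lev_add_le: "lev a + lev b \<le> lev (a + b) + 1"
proof -
  have "(lev a + lev b) * m \<le> a + b + \<rho> + \<rho>"
    using lev_bounds(1)[of a] lev_bounds(1)[of b] by (simp add: algebra_simps)
  also have "\<dots> < (lev (a + b) + 2) * m"
    using lev_bounds(2)[of "a + b"] \<rho>_less by (simp add: algebra_simps)
  finally have "lev a + lev b < lev (a + b) + 2" by (simp only: mult_less_cancel2)
  then show ?thesis by simp
qed

lemma mult_in: "x \<in> S \<Longrightarrow> x + j * m \<in> S"
proof (induction j)
  case (Suc j)
  then show ?case using add_in[of "x + j * m" m] m_in by (simp add: ac_simps)
qed simp

lemma Ap_subset: "Ap \<subseteq> S" by (auto simp: Ap_def)

lemma zero_in_Ap: "0 \<in> Ap" using zero_in m_pos by (auto simp: Ap_def)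

lemma m_notin_Ap: "m \<notin> Ap" using zero_in by (auto simp: Ap_def)

text \<open>If \<open>a = b + (k + 1) * m\<close>, then \<open>a - m = b + k * m\<close> lies in
  \<open>S\<close>, so \<open>a\<close> is not Apery. Hence the columns \<open>a + j * m\<close>
  over distinct Apery elements are disjoint.\<close>

lemma Ap_add_mult_unique:
  assumes "a \<in> Ap" "b \<in> Ap" "a + i * m = b + j * m"
  shows "a = b"
proof -
  have *: "a = b" if "a \<in> Ap" "b \<in> Ap" "a + i * m = b + j * m" "i \<le> j" for a b i j
  proof (rule ccontr)
    assume "a \<noteq> b"
    then have "i < j" using that by (cases "i = j") auto
    then obtain k where "j = i + Suc k" using less_imp_Suc_add by auto
    then have "a = (b + k * m) + m" using that(3) by (simp add: algebra_simps)
    then show False using that(1,2) mult_in Ap_subset by (auto simp: Ap_def)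
  qed
  show ?thesis using *[of a b i j] *[of b a j i] assms by (cases "i \<le> j") auto
qed

text \<open>The shift \<open>k\<close> is \<open>0\<close> for the finiteness of \<open>Ap\<close>
  and \<open>2 * \<rho>\<close> for counting lost levels.\<close>

lemma Ap_mod_inj:
  assumes "a \<in> Ap" "b \<in> Ap" "(a + k) mod m = (b + k) mod m"
  shows "a = b"
proof -
  have "a + k = (a + k) mod m + ((a + k) div m) * m"
       "b + k = (b + k) mod m + ((b + k) div m) * m" by simp_all
  then have "a + ((b + k) div m) * m = b + ((a + k) div m) * m"
    using assms(3) by linarith
  then show ?thesis using Ap_add_mult_unique assms by blast
qed

lemma finite_Ap: "finite Ap"
proof (rule finite_imageD)
  have "(\<lambda>x. x mod m) ` Ap \<subseteq> {..<m}" using m_pos by auto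
  then show "finite ((\<lambda>x. x mod m) ` Ap)" using finite_subset by blast
  show "inj_on (\<lambda>x. x mod m) Ap" using Ap_mod_inj[of _ _ 0] by (auto intro: inj_onI)
qed

lemma finite_Apl [simp]: "finite (Apl i)"
  using finite_Ap by (simp add: Apl_def)

lemma Ap_decompose: "x \<in> S \<Longrightarrow> \<exists>a\<in>Ap. \<exists>j. x = a + j * m"
proof (induction x rule: less_induct)
  case (less x)
  show ?case
  proof (cases "x \<in> Ap")
    case True
    then show ?thesis by (intro bexI[of _ x] exI[of _ 0]) auto
  next
    case False
    then obtain y where y: "y \<in> S" "x = y + m" using less by (auto simp: Ap_def)
    moreover have "y < x" using y m_pos by simp
    ultimately obtain a j where "a \<in> Ap" "y = a + j * m" using less.IH by blast
    then show ?thesis using y by (intro bexI[of _ a] exI[of _ "Suc j"]) auto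
  qed
qed

text \<open>From \<open>a - m \<in> S\<close> would follow \<open>a + b - m \<in> S\<close>. So
  decompositions of Apery elements stay within \<open>Ap\<close>.\<close>

lemma Ap_summand:
  assumes "a + b \<in> Ap" "a \<in> S" "b \<in> S"
  shows "a \<in> Ap"
proof -
  have "a \<noteq> y + m" if "y \<in> S" for y
  proof
    assume "a = y + m"
    then have "a + b = (y + b) + m" by simp
    then show False using assms(1) add_in[OF that assms(3)] by (auto simp: Ap_def)
  qed
  then show ?thesis using assms by (auto simp: Ap_def)
qed

lemma Ap_Dec_split:
  assumes "x \<in> Ap" "x \<in> Dec"
  obtains a b where "a \<in> Ap" "b \<in> Ap" "a \<noteq> 0" "b \<noteq> 0" "x = a + b"
proof -
  obtain a b where ab: "a \<in> S" "b \<in> S" "a \<noteq> 0" "b \<noteq> 0" "x = a + b"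
    using assms by (auto simp: Dec_def)
  then have "a \<in> Ap" "b \<in> Ap"
    using Ap_summand[of a b] Ap_summand[of b a] assms(1) by (auto simp: add.commute)
  then show thesis using that ab by blast
qed

text \<open>If \<open>lev a + lev b = lev (a + b) + 1 = N\<close>, then \<open>a + b\<close> lies in the interval
  \<open>[N m - 2 \<rho>, N m - \<rho>[\<close>, so its residue modulo \<open>m\<close> takes at most \<open>\<rho>\<close> values.\<close>

lemma card_carry_sums:
  assumes "X \<subseteq> Ap"
    and "\<And>x. x \<in> X \<Longrightarrow> \<exists>a b. x = a + b \<and> lev x + 1 = lev a + lev b"
  shows "card X \<le> \<rho>"
proof -
  have "(x + 2 * \<rho>) mod m < \<rho>" if xX: "x \<in> X" for x
  proof -
    obtain a b where ab: "x = a + b" "lev x + 1 = lev a + lev b" using assms(2)[OF xX] by blast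
    have "(lev x + 1) * m \<le> x + 2 * \<rho>"
      unfolding ab(2) using lev_bounds(1)[of a] lev_bounds(1)[of b] ab(1) by (simp add: algebra_simps)
    then obtain k where k: "x + 2 * \<rho> = k + (lev x + 1) * m"
      by (metis add.commute le_Suc_ex)
    then have "k < \<rho>" using lev_bounds(2)[of x] by linarith
    then show ?thesis unfolding k using \<rho>_less by (simp only: mod_mult_self1) simp
  qed
  then have "(\<lambda>x. (x + 2 * \<rho>) mod m) ` X \<subseteq> {..<\<rho>}" by auto
  moreover have "inj_on (\<lambda>x. (x + 2 * \<rho>) mod m) X"
    using Ap_mod_inj[of _ _ "2 * \<rho>"] assms(1) by (auto intro!: inj_onI)
  ultimately show ?thesis using card_inj_on_le[of _ X "{..<\<rho>}"] by auto
qed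

end

section \<open>Counting when nonzero Apery elements have level at least \<open>h\<close>\<close>

locale semigroup_levels_gap = semigroup_levels +
  fixes h :: nat
  assumes h_pos: "1 \<le> h"
    and gap: "x \<in> Ap \<Longrightarrow> x \<noteq> 0 \<Longrightarrow> h \<le> lev x"
begin

definition B :: "nat set" where "B = {x \<in> Ap. h \<le> lev x \<and> lev x < q}"

text \<open>\<open>q - lev x\<close> is the number of elements \<open>x + j * m\<close> below
  \<open>c\<close>, so this is the contribution of \<open>B\<close> to the left part.\<close>

definition weight :: nat where "weight = (\<Sum>x\<in>B. q - lev x)"

lemma finite_B [simp]: "finite B"
  using finite_Ap by (simp add: B_def)

lemma zero_notin_B: "0 \<notin> B"
  using h_pos by (simp add: B_def)

lemma Ap_below_q: "{x \<in> Ap. lev x < q} = insert 0 B"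
  using gap zero_in_Ap q_ge by (auto simp: B_def)

lemma Dec_lev:
  assumes "x \<in> Ap" "x \<in> Dec"
  obtains a b where "a \<in> Ap" "b \<in> Ap" "h \<le> lev a" "lev a \<le> lev b"
    "lev a + lev b \<le> lev x + 1" "x = a + b"
proof -
  obtain a b where ab: "a \<in> Ap" "b \<in> Ap" "a \<noteq> 0" "b \<noteq> 0" "x = a + b"
    using Ap_Dec_split[OF assms] by blast
  have "lev a + lev b \<le> lev x + 1" using lev_add_le ab by simp
  then show thesis
    using that[of a b] that[of b a] gap ab by (cases "lev a \<le> lev b") (auto simp: add.commute)
qed

text \<open>The columns over \<open>insert 0 B\<close> are disjoint; below level \<open>q\<close>,
  the one over \<open>0\<close> contributes \<open>q\<close> elements.\<close>

lemma card_left_ge: "q + weight \<le> card (S \<inter> {..<c})"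
proof -
  let ?P = "SIGMA a:insert 0 B. {..<q - lev a}"
  let ?f = "\<lambda>(a, j). a + j * m"
  have Ap: "insert 0 B \<subseteq> Ap" using Ap_below_q by blast
  have inj: "inj_on ?f ?P"
  proof (rule inj_onI)
    fix p p' assume p: "p \<in> ?P" "p' \<in> ?P" "?f p = ?f p'"
    obtain a j a' j' where e: "p = (a, j)" "p' = (a', j')" by (cases p, cases p')
    then have "a = a'" using Ap_add_mult_unique[of a a' j j'] p Ap by auto
    then show "p = p'" using p m_pos e by simp
  qed
  have "?f ` ?P \<subseteq> S \<inter> {..<c}"
  proof
    fix x assume "x \<in> ?f ` ?P"
    then obtain a j where aj: "a \<in> insert 0 B" "j < q - lev a" "x = a + j * m" by auto
    have "a \<in> S" using aj(1) Ap Ap_subset by blast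
    then have "x \<in> S" using aj mult_in by simp
    moreover have "lev x < q" using aj by simp
    ultimately show "x \<in> S \<inter> {..<c}" using lev_less_iff by auto
  qed
  then have "card ?P \<le> card (S \<inter> {..<c})" using card_inj_on_le[OF inj] by simp
  moreover have "card ?P = q + weight"
    using zero_notin_B by (simp add: weight_def)
  ultimately show ?thesis by simp
qed

text \<open>The extra \<open>1\<close> is \<open>m\<close>: it is indecomposable by minimality,
  below \<open>c\<close> because \<open>q \<ge> 2\<close>, and outside \<open>B\<close> because it
  is not Apery.\<close>

lemma card_primitive_ge: "1 + card (B - Dec) \<le> card {x \<in> S - {0}. x \<notin> Dec \<and> x < c}"
proof -
  have "m \<notin> Dec"
  proof
    assume "m \<in> Dec"
    then obtain a b where "a \<in> S" "b \<in> S" "a \<noteq> 0" "b \<noteq> 0" "m = a + b" by (auto simp: Dec_def)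
    then show False using m_le[of a] by auto
  qed
  moreover have "m < c"
  proof -
    have "2 * m \<le> q * m" using q_ge by simp
    then show ?thesis using c_eq \<rho>_less by linarith
  qed
  ultimately have "insert m (B - Dec) \<subseteq> {x \<in> S - {0}. x \<notin> Dec \<and> x < c}"
    using m_in m_pos zero_notin_B Ap_subset lev_less_iff unfolding B_def
    by (auto intro: gr0I)
  moreover have "finite {x \<in> S - {0}. x \<notin> Dec \<and> x < c}" by simp
  ultimately have "card (insert m (B - Dec)) \<le> card {x \<in> S - {0}. x \<notin> Dec \<and> x < c}"
    by (rule card_mono[rotated])
  moreover have "m \<notin> B - Dec" using m_notin_Ap by (auto simp: B_def)
  ultimately show ?thesis by simp
qed

text \<open>Each column over \<open>insert 0 B\<close> meets level \<open>q\<close> exactly once; an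
  element of \<open>S\<close> of level \<open>q\<close> on none of these columns is itself
  Apery.\<close>

lemma card_decomposable_le:
  "card {x \<in> Dec. lev x = q} \<le> 1 + card B + card (Apl q \<inter> Dec)"
proof -
  have "{x \<in> Dec. lev x = q} \<subseteq> (\<lambda>a. a + (q - lev a) * m) ` insert 0 B \<union> (Apl q \<inter> Dec)"
  proof
    fix x assume x: "x \<in> {x \<in> Dec. lev x = q}"
    then have "x \<in> S" using add_in by (auto simp: Dec_def)
    then obtain a j where a: "a \<in> Ap" "x = a + j * m" using Ap_decompose by blast
    then have q: "q = lev a + j" using x by simp
    show "x \<in> (\<lambda>a. a + (q - lev a) * m) ` insert 0 B \<union> (Apl q \<inter> Dec)"
    proof (cases "j = 0")
      case True
      then show ?thesis using a x by (auto simp: Apl_def)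
    next
      case False
      then have "lev a < q" using q by linarith
      then have "a \<in> insert 0 B" using a(1) Ap_below_q by blast
      moreover have "x = a + (q - lev a) * m" using a(2) q by simp
      ultimately show ?thesis by (intro UnI1 image_eqI)
    qed
  qed
  then have "card {x \<in> Dec. lev x = q}
      \<le> card ((\<lambda>a. a + (q - lev a) * m) ` insert 0 B \<union> (Apl q \<inter> Dec))"
    by (intro card_mono) auto
  also have "\<dots> \<le> card ((\<lambda>a. a + (q - lev a) * m) ` insert 0 B) + card (Apl q \<inter> Dec)"
    by (rule card_Un_le)
  also have "card ((\<lambda>a. a + (q - lev a) * m) ` insert 0 B) \<le> card (insert 0 B)"
    by (rule card_image_le) simp
  also have "card (insert 0 B) = 1 + card B" using zero_notin_B by simp
  finally show ?thesis by simp
qed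

lemma weight_ge:
  assumes "B' \<subseteq> B"
  shows "(\<Sum>x\<in>B'. q - lev x) \<le> weight"
  unfolding weight_def by (rule sum_mono2) (use assms in auto)

lemma sum_weight_Apl:
  assumes "X \<subseteq> Apl i"
  shows "(\<Sum>x\<in>X. q - lev x) = card X * (q - i)"
proof -
  have "(\<Sum>x\<in>X. q - lev x) = (\<Sum>x\<in>X. q - i)"
    by (rule sum.cong) (use assms in \<open>auto simp: Apl_def\<close>)
  then show ?thesis by simp
qed

definition HH :: "nat set" where "HH = {a + b | a b. a \<in> Apl h \<and> b \<in> Apl h}"

lemma finite_HH: "finite HH" and card_HH: "2 * card HH \<le> card (Apl h) * (card (Apl h) + 1)"
  using card_pair_sums[OF finite_Apl, of h] unfolding HH_def by auto

text \<open>Both summands have level at least \<open>h\<close>, and the addition loses at most one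
  level.\<close>

lemma Ap_Dec_low:
  assumes "x \<in> Ap" "x \<in> Dec"
  shows "2 * h \<le> lev x + 1"
  using Dec_lev[OF assms] by (metis add_mono le_trans mult_2)

lemma Ap_Dec_HH:
  assumes "x \<in> Ap" "x \<in> Dec" "lev x + 1 \<le> 2 * h"
  shows "\<exists>a\<in>Apl h. \<exists>b\<in>Apl h. x = a + b"
proof -
  obtain a b where ab: "a \<in> Ap" "b \<in> Ap" "h \<le> lev a" "lev a \<le> lev b"
    "lev a + lev b \<le> lev x + 1" "x = a + b" using Dec_lev[OF assms(1,2)] by blast
  then have "lev a = h" "lev b = h" using assms(3) by auto
  then show ?thesis using ab by (auto simp: Apl_def)
qed

section \<open>Odd depth, \<open>q = 2 * h - 1\<close>\<close>

lemma weight_bound_odd: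
  assumes q: "q + 1 = 2 * h"
  shows "q * (card (B \<inter> Dec) + card (Apl q \<inter> Dec)) \<le> (1 + card (B - Dec)) * weight + \<rho>"
proof -
  define k where "k = card (Apl h)"
  define d where "d = card (Apl q \<inter> Dec)"
  obtain g where g: "h = Suc g" using h_pos by (cases h) auto
  have BD: "B \<inter> Dec = {}"
  proof (rule ccontr)
    assume "B \<inter> Dec \<noteq> {}"
    then obtain x where "x \<in> Ap" "x \<in> Dec" "lev x < q" by (auto simp: B_def)
    then show False using Ap_Dec_low[of x] q by simp
  qed
  have HB: "Apl h \<subseteq> B" using q q_ge by (auto simp: Apl_def B_def)
  have split: "\<exists>a\<in>Apl h. \<exists>b\<in>Apl h. x = a + b" if "x \<in> Apl q \<inter> Dec" for x
    using that Ap_Dec_HH[of x] q by (auto simp: Apl_def)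
  have "d \<le> card HH"
    unfolding d_def by (rule card_mono[OF finite_HH]) (use split in \<open>auto simp: HH_def; blast\<close>)
  then have dk: "2 * d \<le> k * (k + 1)" using card_HH by (simp add: k_def)
  \<comment> \<open>The summands have total level \<open>2 * h = q + 1\<close>, so each of these
    elements has lost a level.\<close>
  have d\<rho>: "d \<le> \<rho>"
    unfolding d_def
  proof (rule card_carry_sums)
    show "Apl q \<inter> Dec \<subseteq> Ap" by (auto simp: Apl_def)
    fix x assume x: "x \<in> Apl q \<inter> Dec"
    obtain a b where "a \<in> Apl h" "b \<in> Apl h" "x = a + b" using split[OF x] by blast
    then show "\<exists>a b. x = a + b \<and> lev x + 1 = lev a + lev b"
      using x q by (intro exI[of _ a] exI[of _ b]) (auto simp: Apl_def)
  qed
  have w: "k * g \<le> weight"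
    using weight_ge[OF HB] sum_weight_Apl[of "Apl h" h] q g by (simp add: k_def)
  have "k \<le> card (B - Dec)"
    using card_mono[OF finite_B HB] BD by (simp add: k_def Diff_triv)
  then have "(1 + k) * (k * g) \<le> (1 + card (B - Dec)) * weight"
    using w by (intro mult_mono) auto
  \<comment> \<open>As \<open>q = 2 * g + 1\<close>, the triangular bound pays for
    \<open>2 * g\<close> copies of \<open>d\<close> and \<rho> for the last one.\<close>
  moreover have "q * d = g * (2 * d) + d" using q g by (simp add: algebra_simps)
  moreover have "g * (2 * d) \<le> g * (k * (k + 1))" using dk by (rule mult_le_mono2)
  ultimately have "q * d \<le> (1 + card (B - Dec)) * weight + \<rho>"
    using d\<rho> by (simp add: algebra_simps)
  then show ?thesis using BD by (simp add: d_def)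
qed

section \<open>Even depth, \<open>q = 2 * h\<close>\<close>

context
  assumes q: "q = 2 * h"
begin

lemma E_split:
  assumes "x \<in> Apl (q - 1) \<inter> Dec"
  shows "\<exists>a\<in>Apl h. \<exists>b\<in>Apl h. x = a + b"
  using assms Ap_Dec_HH[of x] q h_pos by (auto simp: Apl_def)

text \<open>The levels of the summands total at most \<open>2 * h + 1\<close>, so outside
  \<open>HH\<close> they can only be \<open>h\<close> and \<open>h + 1\<close>.\<close>

lemma D_split:
  assumes "x \<in> Apl q \<inter> Dec - HH"
  shows "\<exists>a\<in>Apl h. \<exists>b\<in>Apl (h + 1). x = a + b"
proof -
  have x: "x \<in> Ap" "x \<in> Dec" "lev x = q" using assms by (auto simp: Apl_def)
  obtain a b where ab: "a \<in> Ap" "b \<in> Ap" "h \<le> lev a" "lev a \<le> lev b"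
    "lev a + lev b \<le> lev x + 1" "x = a + b" using Dec_lev[OF x(1,2)] by blast
  have "\<not> (lev a = h \<and> lev b = h)"
  proof
    assume "lev a = h \<and> lev b = h"
    then have "a \<in> Apl h" "b \<in> Apl h" using ab(1,2) by (simp_all add: Apl_def)
    then have "x \<in> HH" using ab(6) unfolding HH_def by blast
    then show False using assms by simp
  qed
  then have "lev a = h" "lev b = h + 1" using ab(3-5) x(3) q by linarith+
  then show ?thesis using ab by (auto simp: Apl_def)
qed

lemma B_Dec: "B \<inter> Dec = Apl (q - 1) \<inter> Dec"
proof
  show "B \<inter> Dec \<subseteq> Apl (q - 1) \<inter> Dec"
  proof
    fix x assume "x \<in> B \<inter> Dec"
    then show "x \<in> Apl (q - 1) \<inter> Dec"
      using Ap_Dec_low[of x] q unfolding B_def Apl_def by auto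
  qed
  show "Apl (q - 1) \<inter> Dec \<subseteq> B \<inter> Dec"
    using q h_pos unfolding B_def Apl_def by auto
qed

text \<open>Level \<open>2 * h - 1\<close> arises from \<open>h + h\<close>, and level
  \<open>2 * h\<close> outside \<open>HH\<close> from \<open>h + (h + 1)\<close>; in both sets every
  element has lost a level.\<close>

lemma card_E_D_le_offset:
  "card (Apl (q - 1) \<inter> Dec) + card (Apl q \<inter> Dec - HH) \<le> \<rho>"
proof -
  let ?E = "Apl (q - 1) \<inter> Dec" and ?D = "Apl q \<inter> Dec - HH"
  have "card (?E \<union> ?D) \<le> \<rho>"
  proof (rule card_carry_sums)
    show "?E \<union> ?D \<subseteq> Ap" by (auto simp: Apl_def)
    fix x assume "x \<in> ?E \<union> ?D"
    then show "\<exists>a b. x = a + b \<and> lev x + 1 = lev a + lev b"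
    proof
      assume x: "x \<in> ?E"
      then obtain a b where "a \<in> Apl h" "b \<in> Apl h" "x = a + b" using E_split by blast
      moreover have "lev x + 1 = 2 * h" using x q h_pos by (auto simp: Apl_def)
      ultimately show ?thesis by (intro exI[of _ a] exI[of _ b]) (auto simp: Apl_def)
    next
      assume x: "x \<in> ?D"
      then obtain a b where "a \<in> Apl h" "b \<in> Apl (h + 1)" "x = a + b" using D_split by blast
      moreover have "lev x = 2 * h" using x q by (auto simp: Apl_def)
      ultimately show ?thesis by (intro exI[of _ a] exI[of _ b]) (auto simp: Apl_def)
    qed
  qed
  moreover have "card (?E \<union> ?D) = card ?E + card ?D"
    using q_ge by (intro card_Un_disjoint finite_Int finite_Diff disjI1 finite_Apl) (auto simp: Apl_def)
  ultimately show ?thesis by simp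
qed

text \<open>Both sets lie in \<open>HH\<close> at different levels, so one triangular bound serves
  them jointly.\<close>

lemma card_E_HH:
  "2 * (card (Apl (q - 1) \<inter> Dec) + card (Apl q \<inter> HH)) \<le> card (Apl h) * (card (Apl h) + 1)"
proof -
  let ?E = "Apl (q - 1) \<inter> Dec" and ?D = "Apl q \<inter> HH"
  have "?E \<subseteq> HH" unfolding HH_def by (intro subsetI CollectI) (use E_split in blast)
  then have "card (?E \<union> ?D) \<le> card HH" by (intro card_mono finite_HH) auto
  moreover have "card (?E \<union> ?D) = card ?E + card ?D"
    using q_ge by (intro card_Un_disjoint finite_Int finite_Diff disjI1 finite_Apl) (auto simp: Apl_def)
  ultimately show ?thesis using card_HH by simp
qed

lemma card_D_le: "card (Apl q \<inter> Dec) \<le> card (Apl q \<inter> HH) + card (Apl q \<inter> Dec - HH)"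
proof -
  have "card (Apl q \<inter> Dec) \<le> card ((Apl q \<inter> HH) \<union> (Apl q \<inter> Dec - HH))"
    by (rule card_mono) auto
  also have "\<dots> \<le> card (Apl q \<inter> HH) + card (Apl q \<inter> Dec - HH)" by (rule card_Un_le)
  finally show ?thesis .
qed

text \<open>For \<open>h \<ge> 3\<close> one has \<open>h + 1 < 2 * h - 1\<close>, so
  \<open>Apl (h + 1)\<close> too contains no decomposable element and adds to
  \<open>card (B - Dec)\<close>.\<close>

lemma weight_bound_even_large:
  assumes h: "3 \<le> h"
  shows "q * (card (B \<inter> Dec) + card (Apl q \<inter> Dec)) \<le> (1 + card (B - Dec)) * weight + \<rho>"
proof -
  define k l where "k = card (Apl h)" and "l = card (Apl (h + 1))"
  define e d1 d2 where "e = card (Apl (q - 1) \<inter> Dec)" and "d1 = card (Apl q \<inter> HH)"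
    and "d2 = card (Apl q \<inter> Dec - HH)"
  obtain g where g: "h = Suc g" using h_pos by (cases h) auto
  have sub: "Apl h \<union> Apl (h + 1) \<subseteq> B" using h q unfolding Apl_def B_def by auto
  have disj: "Apl h \<inter> Apl (h + 1) = {}" by (auto simp: Apl_def)
  have "(Apl h \<union> Apl (h + 1)) \<inter> Dec = {}"
    using Ap_Dec_low h by (fastforce simp: Apl_def)
  then have "card (Apl h \<union> Apl (h + 1)) \<le> card (B - Dec)"
    using sub by (intro card_mono) auto
  then have p: "k + l \<le> card (B - Dec)"
    using disj by (simp add: card_Un_disjoint k_def l_def)
  have "(\<Sum>x\<in>Apl h \<union> Apl (h + 1). q - lev x) = k * h + l * g"
    using disj q g sum_weight_Apl[of "Apl h" h] sum_weight_Apl[of "Apl (h + 1)" "h + 1"]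
    by (simp add: sum.union_disjoint k_def l_def)
  then have w: "k * h + l * g \<le> weight" using weight_ge[OF sub] by simp
  have "(1 + (k + l)) * (k * h + l * g) \<le> (1 + card (B - Dec)) * weight"
    using p w by (intro mult_mono) auto
  moreover have "q * (e + d1) \<le> h * (k * (k + 1))"
    using mult_le_mono2[OF card_E_HH, of h] q by (simp add: k_def e_def d1_def algebra_simps)
  \<comment> \<open>Of the \<open>2 * g + 2\<close> copies of \<open>d2\<close>, one is bounded by
    \<rho> and the others by \<open>k * l\<close>; the product has \<open>k * l\<close> with
    coefficient \<open>h + g = 2 * g + 1\<close>.\<close>
  moreover have "q * d2 \<le> 2 * g * (k * l) + k * l + \<rho>"
  proof -
    have "Apl q \<inter> Dec - HH \<subseteq> {a + b | a b. a \<in> Apl h \<and> b \<in> Apl (h + 1)}"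
      using D_split by (intro subsetI CollectI) blast
    then have "d2 \<le> card {a + b | a b. a \<in> Apl h \<and> b \<in> Apl (h + 1)}"
      unfolding d2_def using card_sums_le[of "Apl h" "Apl (h + 1)"] by (intro card_mono) auto
    then have "d2 \<le> k * l"
      using card_sums_le[of "Apl h" "Apl (h + 1)"] by (simp add: k_def l_def)
    moreover from this have "2 * g * d2 \<le> 2 * g * (k * l)" by (rule mult_le_mono2)
    moreover have "d2 \<le> \<rho>" using card_E_D_le_offset by (simp add: d2_def)
    moreover have "q * d2 = 2 * g * d2 + d2 + d2" using q g by (simp add: algebra_simps)
    ultimately show ?thesis by linarith
  qed
  moreover have "h * (k * (k + 1)) + 2 * g * (k * l) + k * l \<le> (1 + (k + l)) * (k * h + l * g)"
    using g by (simp add: algebra_simps)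
  moreover have "q * (e + card (Apl q \<inter> Dec)) \<le> q * (e + d1) + q * d2"
    using mult_le_mono2[OF card_D_le, of q] by (simp add: d1_def d2_def algebra_simps)
  ultimately show ?thesis unfolding B_Dec e_def by linarith
qed

text \<open>The summand of level \<open>3\<close> is either indecomposable, which leaves at most
  \<open>card (Apl 2) * card (Apl 3 - Dec)\<close> sums, or itself a sum from \<open>Apl 2\<close>,
  which leads to triple sums.\<close>

lemma card_D_depth_four:
  assumes h: "h = 2"
  shows "3 * card (Apl q \<inter> Dec - HH)
    \<le> 3 * (card (Apl 2) * card (Apl 3 - Dec)) + (card (Apl 2) + 2) * card (Apl 3 \<inter> Dec)"
proof -
  define X where "X = {x \<in> Apl q. \<exists>s\<in>Apl 3 \<inter> Dec. \<exists>a\<in>Apl 2. x = s + a}"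
  let ?Y = "{a + b | a b. a \<in> Apl 2 \<and> b \<in> Apl 3 - Dec}"
  have q4: "q = 4" using q h by simp
  have X: "3 * card X \<le> (card (Apl 2) + 2) * card (Apl 3 \<inter> Dec)"
  proof (rule card_triple_sums)
    show "\<exists>a\<in>Apl 2. \<exists>b\<in>Apl 2. s = a + b" if "s \<in> Apl 3 \<inter> Dec" for s
      using E_split[of s] that q4 h by simp
    show "\<exists>s\<in>Apl 3 \<inter> Dec. \<exists>c\<in>Apl 2. x = s + c" if "x \<in> X" for x
      using that by (auto simp: X_def)
    show "a + b \<in> Apl 3 \<inter> Dec"
      if "a \<in> Apl 2" "b \<in> Apl 2" "c \<in> Apl 2" "a + b + c \<in> X" for a b c
    proof -
      have S: "a \<in> S" "b \<in> S" "c \<in> S" using that Ap_subset by (auto simp: Apl_def)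
      have l: "lev a = 2" "lev b = 2" "lev c = 2" "lev (a + b + c) = 4"
        using that q4 by (auto simp: X_def Apl_def)
      have "a + b + c \<in> Ap" using that by (auto simp: X_def Apl_def)
      then have "a + b \<in> Ap" using Ap_summand[of "a + b" c] S add_in by simp
      \<comment> \<open>The levels of \<open>a\<close> and \<open>b\<close> force at least
        \<open>3\<close>; adding \<open>c\<close> and landing in level \<open>4\<close> allows at
        most \<open>3\<close>.\<close>
      moreover have "lev (a + b) = 3"
        using lev_add_le[of a b] lev_add_le[of "a + b" c] l by simp
      moreover have "a \<noteq> 0" "b \<noteq> 0" using l by (metis lev_0 zero_neq_numeral)+
      ultimately show ?thesis using S by (auto simp: Apl_def Dec_def)
    qed
  qed auto
  have "Apl q \<inter> Dec - HH \<subseteq> ?Y \<union> X"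
  proof
    fix x assume x: "x \<in> Apl q \<inter> Dec - HH"
    obtain a b where ab: "a \<in> Apl 2" "b \<in> Apl 3" "x = a + b" using D_split[OF x] h by auto
    show "x \<in> ?Y \<union> X"
    proof (cases "b \<in> Dec")
      case True
      then have "\<exists>s\<in>Apl 3 \<inter> Dec. \<exists>a\<in>Apl 2. x = s + a"
        using ab by (intro bexI[of _ b] bexI[of _ a]) auto
      then show ?thesis using x by (simp add: X_def)
    qed (use ab in blast)
  qed
  moreover have Y: "finite ?Y" "card ?Y \<le> card (Apl 2) * card (Apl 3 - Dec)"
    using card_sums_le[of "Apl 2" "Apl 3 - Dec"] by auto
  moreover have "finite X" by (simp add: X_def)
  ultimately have "card (Apl q \<inter> Dec - HH) \<le> card (?Y \<union> X)" by (intro card_mono) auto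
  also have "\<dots> \<le> card ?Y + card X" by (rule card_Un_le)
  finally show ?thesis using X Y by linarith
qed

lemma weight_bound_depth_four:
  assumes h: "h = 2"
  shows "q * (card (B \<inter> Dec) + card (Apl q \<inter> Dec)) \<le> (1 + card (B - Dec)) * weight + \<rho>"
proof -
  have q4: "q = 4" using q h by simp
  define k l where "k = card (Apl 2)" and "l = card (Apl 3 - Dec)"
  define e d1 d2 where "e = card (Apl 3 \<inter> Dec)" and "d1 = card (Apl q \<inter> HH)"
    and "d2 = card (Apl q \<inter> Dec - HH)"
  have B: "B = Apl 2 \<union> Apl 3" using h q4 unfolding Apl_def B_def by auto
  have disj: "Apl 2 \<inter> Apl 3 = {}" by (auto simp: Apl_def)
  have "Apl 2 \<inter> Dec = {}" using Ap_Dec_low h by (fastforce simp: Apl_def)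
  then have "B - Dec = Apl 2 \<union> (Apl 3 - Dec)" using B by blast
  then have p: "card (B - Dec) = k + l"
    using disj card_Un_disjoint[of "Apl 2" "Apl 3 - Dec"] by (auto simp: k_def l_def)
  have c3: "card (Apl 3) = l + e"
    using card_Int_Diff[of "Apl 3" Dec] by (simp add: l_def e_def)
  have w: "weight = 2 * k + l + e"
    using disj q4 c3 sum_weight_Apl[of "Apl 2" 2] sum_weight_Apl[of "Apl 3" 3]
    unfolding weight_def B by (simp add: sum.union_disjoint k_def)
  \<comment> \<open>The extra \<open>e\<close> completes the group \<open>e + d2\<close>, which
    \<rho> bounds. It also absorbs the gap between the \<open>(k + 2) * e\<close> of the triple sums
    and the \<open>(k + 1) * e\<close> found in the final product.\<close>
  have "4 * (e + card (Apl q \<inter> Dec)) + e \<le> 4 * (e + d1) + (e + d2) + 3 * d2"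
    using card_D_le by (simp add: d1_def d2_def)
  also have "\<dots> \<le> 2 * (k * (k + 1)) + \<rho> + (3 * (k * l) + (k + 2) * e)"
  proof (intro add_mono)
    show "4 * (e + d1) \<le> 2 * (k * (k + 1))"
      using card_E_HH q4 h by (simp add: k_def e_def d1_def)
    show "e + d2 \<le> \<rho>" using card_E_D_le_offset q4 by (simp add: e_def d2_def)
    show "3 * d2 \<le> 3 * (k * l) + (k + 2) * e"
      using card_D_depth_four[OF h] by (simp add: k_def l_def e_def d2_def)
  qed
  also have "\<dots> \<le> (1 + (k + l)) * (2 * k + l + e) + \<rho> + e" by (simp add: algebra_simps)
  finally have "4 * (e + card (Apl q \<inter> Dec)) \<le> (1 + (k + l)) * (2 * k + l + e) + \<rho>"
    by simp
  then show ?thesis unfolding B_Dec p w using q4 by (simp add: e_def)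
qed

end

section \<open>The inequality in natural numbers, for both parities\<close>

lemma W0_nonneg:
  assumes "4 \<le> q" "q = 2 * h \<or> q + 1 = 2 * h"
  shows "int q * int (card {x \<in> Dec. lev x = q})
    \<le> int (card {x \<in> S - {0}. x \<notin> Dec \<and> x < c}) * int (card (S \<inter> {..<c})) + int \<rho>"
proof -
  have main: "q * (card (B \<inter> Dec) + card (Apl q \<inter> Dec)) \<le> (1 + card (B - Dec)) * weight + \<rho>"
  proof (cases "q + 1 = 2 * h")
    case True
    then show ?thesis by (rule weight_bound_odd)
  next
    case False
    then have "q = 2 * h" "h = 2 \<or> 3 \<le> h" using assms by linarith+
    then show ?thesis using weight_bound_depth_four weight_bound_even_large by blast
  qed
  have "q * card {x \<in> Dec. lev x = q} \<le> q * (1 + card B + card (Apl q \<inter> Dec))"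
    using card_decomposable_le by (rule mult_le_mono2)
  also have "card B = card (B - Dec) + card (B \<inter> Dec)"
    using card_Int_Diff[of B Dec] by simp
  \<comment> \<open>The term \<open>q * (1 + card (B - Dec))\<close> occurs on both sides; what
    remains is \<open>main\<close>.\<close>
  also have "q * (1 + (card (B - Dec) + card (B \<inter> Dec)) + card (Apl q \<inter> Dec))
      \<le> (1 + card (B - Dec)) * (q + weight) + \<rho>"
    using main by (simp add: algebra_simps)
  also have "(1 + card (B - Dec)) * (q + weight)
      \<le> card {x \<in> S - {0}. x \<notin> Dec \<and> x < c} * card (S \<inter> {..<c})"
    by (intro mult_mono card_primitive_ge card_left_ge) auto
  finally have "q * card {x \<in> Dec. lev x = q}
      \<le> card {x \<in> S - {0}. x \<notin> Dec \<and> x < c} * card (S \<inter> {..<c}) + \<rho>" by simp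
  then show ?thesis by (simp flip: of_nat_mult of_nat_add)
qed

end

section \<open>Transfer to the integer-valued definitions\<close>

theorem theorem3p1:
  fixes S :: "nat set" and h :: int
  assumes "numerical_semigroup S"
    and "ns_depth S \<ge> 4"
    and "h = \<lceil>real_of_int (ns_depth S) / 2\<rceil>"
    and "\<forall>i::int. 1 \<le> i \<and> i \<le> h - 1 \<longrightarrow> ns_alpha S i = 0"
  shows "ns_W0 S \<ge> 0"
proof -
  define m c where "m = ns_multiplicity S" and "c = ns_conductor S"
  define q \<rho> h' where "q = nat (ns_depth S)" and "\<rho> = nat (ns_offset S)" and "h' = nat h"
  have S: "0 \<in> S" "\<And>x y. x \<in> S \<Longrightarrow> y \<in> S \<Longrightarrow> x + y \<in> S" "finite (UNIV - S)"
    using assms(1) by (auto simp: numerical_semigroup_def)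
  have "infinite S" using S(3) by (metis finite_Diff2 infinite_UNIV_nat)
  then obtain x where "x \<in> S" "x \<noteq> 0" by (metis finite.emptyI finite_insert finite_subset insertI1 subsetI)
  then have "x \<in> ns_star S" by (simp add: ns_star_def)
  then have m_star: "m \<in> ns_star S" unfolding m_def ns_multiplicity_def by (rule LeastI)
  have m_le: "m \<le> x" if "x \<in> S" "x \<noteq> 0" for x
    unfolding m_def ns_multiplicity_def by (rule Least_le) (use that in \<open>simp add: ns_star_def\<close>)
  have m_in: "m \<in> S" and m_pos: "0 < m" using m_star by (auto simp: ns_star_def)
  have q_eq: "ns_depth S = int q" and q4: "4 \<le> q" using assms(2) by (auto simp: q_def)
  \<comment> \<open>The ceiling is turned into \<open>c \<le> q * m\<close> and
    \<open>q * m < c + m\<close>; the latter gives \<open>\<rho> < m\<close>.\<close>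
  have "real c / real m \<le> real q" "real q - 1 < real c / real m"
    using q_eq ceiling_correct[of "real c / real m"] by (auto simp: ns_depth_def c_def m_def)
  then have "real c \<le> real q * real m" "real q * real m < real c + real m"
    using m_pos by (auto simp: field_simps)
  then have c_le: "c \<le> q * m" "q * m < c + m"
    by (metis of_nat_le_iff of_nat_mult, metis of_nat_add of_nat_less_iff of_nat_mult)
  have \<rho>_eq: "ns_offset S = int \<rho>" and c_eq: "c + \<rho> = q * m"
    using c_le
    by (simp_all add: \<rho>_def ns_offset_def q_eq flip: m_def c_def of_nat_mult of_nat_diff)
  interpret semigroup_levels S m c q \<rho>
    by unfold_locales (use S m_in m_le c_eq c_le q4 in auto)
  have interval: "int x \<in> ns_interval S (int j) \<longleftrightarrow> lev x = j" for x j
  proof -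
    have "int x \<in> ns_interval S (int j)
        \<longleftrightarrow> int (j * m) \<le> int (x + \<rho>) \<and> int (x + \<rho>) < int ((j + 1) * m)"
      by (auto simp: ns_interval_def \<rho>_eq algebra_simps simp flip: m_def)
    then show ?thesis unfolding lev_eq_iff by (simp only: of_nat_le_iff of_nat_less_iff)
  qed
  have Ap: "ns_apery S = Ap"
  proof -
    have "int x - int m \<in> int ` S \<longleftrightarrow> (\<exists>y\<in>S. x = y + m)" for x
      by (auto simp: image_iff) (metis diff_eq_eq of_nat_add of_nat_eq_iff)
    then show ?thesis by (auto simp: ns_apery_def Ap_def simp flip: m_def)
  qed
  have h: "q = 2 * h' \<or> q + 1 = 2 * h'" "int h' = h"
  proof -
    have "h = \<lceil>real q / 2\<rceil>" using assms(3) q_eq by simp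
    then have "real_of_int h - 1 < real q / 2" "real q / 2 \<le> real_of_int h"
      using ceiling_correct by blast+
    then have "2 * h < int q + 2" "int q \<le> 2 * h" by linarith+
    then show "q = 2 * h' \<or> q + 1 = 2 * h'" "int h' = h" by (auto simp: h'_def)
  qed
  interpret semigroup_levels_gap S m c q \<rho> h'
  proof unfold_locales
    show "1 \<le> h'" using h q4 by linarith
    fix x assume x: "x \<in> Ap" "x \<noteq> 0"
    show "h' \<le> lev x"
    proof (rule ccontr)
      assume less: "\<not> h' \<le> lev x"
      \<comment> \<open>The assumption on \<open>ns_alpha\<close> starts at \<open>1\<close>; level
        \<open>0\<close> is excluded because nonzero elements of \<open>S\<close> are at least
        \<open>m\<close>.\<close>
      have "lev x \<noteq> 0"
      proof
        assume "lev x = 0"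
        then have "x < m" using lev_bounds(2)[of x] by simp
        then show False using x m_le[of x] Ap_subset by auto
      qed
      then have "ns_alpha S (int (lev x)) = 0" using assms(4) less h(2) by force
      moreover have "ns_apery_in S (int (lev x)) = Apl (lev x)"
        by (simp add: ns_apery_in_def Ap interval Apl_def)
      ultimately have "Apl (lev x) = {}" by (simp add: ns_alpha_def)
      then show False using x by (auto simp: Apl_def)
    qed
  qed
  have Dec: "ns_decomposable S = Dec"
    using S(2) by (auto simp: ns_decomposable_def ns_primitive_def ns_star_def Dec_def)
  have "ns_primitive S = {x \<in> S - {0}. x \<notin> Dec}"
    by (auto simp: ns_primitive_def ns_star_def Dec_def)
  then have "ns_primitive S \<inter> ns_left S = {x \<in> S - {0}. x \<notin> Dec \<and> x < c}"
    by (auto simp: ns_left_def simp flip: c_def)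
  moreover have "ns_left S = S \<inter> {..<c}" by (simp add: ns_left_def c_def)
  moreover have "ns_decomposable_in S (ns_depth S) = {x \<in> Dec. lev x = q}"
    by (simp add: ns_decomposable_in_def q_eq interval Dec)
  ultimately show ?thesis
    using W0_nonneg[OF q4 h(1)] by (simp add: ns_W0_def q_eq \<rho>_eq)
qed

end
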